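(* Let $A,B$ be integers, let $A^{(i)}=(0,a_i)$ and $E^{(i)}=(B-b_i,A)$ for $i=1,\dots,n$, and let $S_k=(x_k,y_k)$, $k=1,\dots,m$, be lattice points, where $a_1>a_2>\dots>a_n$, $b_1>b_2>\dots>b_n$, $0\le x_k\le B-b_n$ and $a_n\le y_k\le A$. Then the maximum of the total number of NE-turns $\sum_{i=1}^n\mathrm{NE}(P_i)$ over all families $(P_1,\dots,P_n)$ of non-intersecting lattice paths, where $P_i$ runs from $A^{(i)}$ to $E^{(i)}$ and stays weakly south-east of $S_k$ for all $k=1,\dots,m$, equals $\sum_{i=1}^n t_i$, where $$t_i=B-a_i-b_i-\max\Bigl(\{-a_j+2(i-j),\;B-A-b_j+2(i-j):1\le j\le i\}\cup\{x_k-y_k+2(i-1):1\le k\le m\}\Bigr).$$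
   Context: A lattice path is a finite sequence of points of $\mathbb Z^2$ in which each successive difference is $(1,0)$ or $(0,1)$; it runs from its first to its last point. A family of lattice paths is non-intersecting if no two paths of the family have a point in common. A NE-turn of a lattice path is a point of the path which is the end point of a vertical step $(0,1)$ and the starting point of a horizontal step $(1,0)$; $\mathrm{NE}(P)$ denotes the number of NE-turns of $P$. A lattice path stays weakly south-east of a point $S=(s_1,s_2)$ if every point $(x,y)$ of the path satisfies $x\ge s_1$ or $y\le s_2$ (or both).
   Formalization: The formal statement also assumes n≥1, a_1≤A, 0≤B-b_1, and x_k≤B-b_1, a_1≤y_k for all k; without these no family need exist, or the formula can fail (n=2, A=B=2, a=b=(1,0), S_1=(0,0): maximum at least 2, formula gives 0). *)

theory Defs
  imports Main "HOL-Library.Product_Plus"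
begin

definition lattice_path :: "(int \<times> int) list \<Rightarrow> bool" where
  "lattice_path P \<longleftrightarrow>
     P \<noteq> [] \<and> successively (\<lambda>p q. q - p = (1, 0) \<or> q - p = (0, 1)) P"

definition runs_from_to :: "(int \<times> int) list \<Rightarrow> int \<times> int \<Rightarrow> int \<times> int \<Rightarrow> bool" where
  "runs_from_to P p q \<longleftrightarrow> hd P = p \<and> last P = q"

definition NE_turns :: "(int \<times> int) list \<Rightarrow> (int \<times> int) set" where
  "NE_turns P = {P ! j | j. 0 < j \<and> j + 1 < length P \<and>
     P ! j - P ! (j - 1) = (0, 1) \<and> P ! (j + 1) - P ! j = (1, 0)}"

definition NE :: "(int \<times> int) list \<Rightarrow> nat" where
  "NE P = card (NE_turns P)"

definition weakly_south_east :: "(int \<times> int) list \<Rightarrow> int \<times> int \<Rightarrow> bool" where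
  "weakly_south_east P S \<longleftrightarrow> (\<forall>(x, y) \<in> set P. fst S \<le> x \<or> y \<le> snd S)"

text \<open>Families are indexed by \<open>{1..n}\<close>; values of \<open>P\<close> outside this range are irrelevant.\<close>

definition non_intersecting :: "nat \<Rightarrow> (nat \<Rightarrow> (int \<times> int) list) \<Rightarrow> bool" where
  "non_intersecting n P \<longleftrightarrow>
     (\<forall>i\<in>{1..n}. \<forall>j\<in>{1..n}. i \<noteq> j \<longrightarrow> set (P i) \<inter> set (P j) = {})"

definition path_families ::
  "int \<Rightarrow> int \<Rightarrow> nat \<Rightarrow> (nat \<Rightarrow> int) \<Rightarrow> (nat \<Rightarrow> int) \<Rightarrow> nat \<Rightarrow> (nat \<Rightarrow> int) \<Rightarrow> (nat \<Rightarrow> int)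
    \<Rightarrow> (nat \<Rightarrow> (int \<times> int) list) set" where
  "path_families A B n a b m x y =
     {P. non_intersecting n P \<and>
         (\<forall>i\<in>{1..n}. lattice_path (P i) \<and>
            runs_from_to (P i) (0, a i) (B - b i, A) \<and>
            (\<forall>k\<in>{1..m}. weakly_south_east (P i) (x k, y k)))}"

definition t_val ::
  "int \<Rightarrow> int \<Rightarrow> (nat \<Rightarrow> int) \<Rightarrow> (nat \<Rightarrow> int) \<Rightarrow> nat \<Rightarrow> (nat \<Rightarrow> int) \<Rightarrow> (nat \<Rightarrow> int) \<Rightarrow> nat \<Rightarrow> int" where
  "t_val A B a b m x y i = B - a i - b i -
     Max ((\<Union>j\<in>{1..i}. {- a j + 2 * (int i - int j), B - A - b j + 2 * (int i - int j)})
          \<union> {x k - y k + 2 * (int i - 1) | k. k \<in> {1..m}})"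

end

theory Submission
  imports Defs
begin

text \<open>
  Disjointness pushes the \<open>i\<close>-th path weakly south-east of every point of the \<open>j\<close>-th path, shifted
  by \<open>(i - j, j - i)\<close>, for \<open>j \<le> i\<close>. Hence the \<open>i\<close>-th path stays weakly south-east of the shifted
  starting points, end points and restrictions \<open>S\<^sub>k\<close>. A path from \<open>(0, a)\<close> to \<open>(X, A)\<close> that stays
  weakly south-east of \<open>(u, v)\<close> has at most \<open>v - a\<close> NE-turns to the left of \<open>u\<close> and at most \<open>X - u\<close>
  others, so it has at most \<open>X - a - (u - v)\<close> of them.

  Let \<open>c\<close> be the maximum in the definition of \<open>t\<^sub>i\<close>. Going horizontally to the line \<open>x - y = c\<close>, then
  along the staircase between the lines \<open>x - y = c - 1\<close> and \<open>x - y = c\<close>, and finally vertically,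
  attains the bound for the single path. The maxima for consecutive \<open>i\<close> differ by at least \<open>2\<close>, so
  these staircases are disjoint.
\<close>

section \<open>Lattice paths\<close>

lemma lattice_path_step:
  assumes "lattice_path P" "Suc j < length P"
  shows "P ! Suc j = P ! j + (1, 0) \<or> P ! Suc j = P ! j + (0, 1)"
proof -
  have "P ! Suc j - P ! j = (1, 0) \<or> P ! Suc j - P ! j = (0, 1)"
    using assms by (auto simp: lattice_path_def successively_conv_nth)
  then show ?thesis by (metis add.commute diff_add_cancel)
qed

lemma lattice_path_mono:
  assumes "lattice_path P" "i \<le> j" "j < length P"
  shows "fst (P ! i) \<le> fst (P ! j) \<and> snd (P ! i) \<le> snd (P ! j)"
  using assms(2,3)
proof (induction j rule: dec_induct)
  case (step j)
  with lattice_path_step[OF assms(1), of j] show ?case by auto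
qed simp

lemma lattice_path_antidiagonal:
  assumes "lattice_path P" "j < length P"
  shows "fst (P ! j) + snd (P ! j) = fst (P ! 0) + snd (P ! 0) + int j"
  using assms(2)
proof (induction j)
  case (Suc j)
  with lattice_path_step[OF assms(1), of j] show ?case by auto
qed simp

lemma lattice_path_endpoints:
  assumes "lattice_path P" "runs_from_to P p q"
  shows "P ! 0 = p" "P ! (length P - 1) = q" "0 < length P"
  using assms by (auto simp: lattice_path_def runs_from_to_def hd_conv_nth last_conv_nth)

lemma lattice_path_length:
  assumes "lattice_path P" "runs_from_to P p q"
  shows "int (length P) = fst q + snd q - fst p - snd p + 1"
  using lattice_path_antidiagonal[OF assms(1), of "length P - 1"] lattice_path_endpoints[OF assms]
  by (simp add: of_nat_diff)

lemma lattice_path_box: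
  assumes "lattice_path P" "runs_from_to P p q" "r \<in> set P"
  shows "fst p \<le> fst r \<and> fst r \<le> fst q \<and> snd p \<le> snd r \<and> snd r \<le> snd q"
proof -
  obtain j where j: "j < length P" "r = P ! j" using assms(3) by (auto simp: in_set_conv_nth)
  show ?thesis
    using lattice_path_mono[OF assms(1), of 0 j] lattice_path_mono[OF assms(1), of j "length P - 1"]
      lattice_path_endpoints[OF assms(1,2)] j by auto
qed

lemma weakly_south_eastD:
  assumes "weakly_south_east P S" "r \<in> set P"
  shows "fst S \<le> fst r \<or> snd r \<le> snd S"
  using assms by (auto simp: weakly_south_east_def)

text \<open>The first point with abscissa at least \<open>fst S\<close> works: its predecessor lies
  strictly left of \<open>S\<close>, hence at height at most \<open>snd S\<close>, and the step
  between them is horizontal.\<close>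

lemma weakly_south_east_witness:
  assumes P: "lattice_path P" "runs_from_to P p q"
    and se: "weakly_south_east P S"
    and "fst p \<le> fst S" "fst S \<le> fst q" "snd p \<le> snd S"
  shows "\<exists>r\<in>set P. fst r = fst S \<and> snd r \<le> snd S"
proof -
  note ends = lattice_path_endpoints[OF P]
  define Q where "Q j \<longleftrightarrow> j < length P \<and> fst S \<le> fst (P ! j)" for j
  define j where "j = (LEAST j. Q j)"
  have "Q (length P - 1)" using ends assms by (auto simp: Q_def)
  then have Qj: "Q j" unfolding j_def by (rule LeastI)
  show ?thesis
  proof (cases j)
    case 0
    then show ?thesis using Qj ends assms by (auto simp: Q_def intro!: bexI[of _ "P ! 0"])
  next
    case (Suc k)
    then have "\<not> Q k" unfolding j_def using not_less_Least[of k Q] by simp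
    then have lt: "fst (P ! k) < fst S" using Qj Suc by (auto simp: Q_def)
    have "snd (P ! k) \<le> snd S"
      using weakly_south_eastD[OF se, of "P ! k"] lt Qj Suc by (auto simp: Q_def)
    then have "fst (P ! Suc k) = fst S \<and> snd (P ! Suc k) \<le> snd S"
      using lt lattice_path_step[OF P(1), of k] Qj Suc by (auto simp: Q_def)
    moreover have "P ! Suc k \<in> set P" using Qj Suc by (simp add: Q_def)
    ultimately show ?thesis by blast
  qed
qed

section \<open>Bounding the number of NE-turns\<close>

lemma NE_turns_subset: "NE_turns P \<subseteq> set P"
  by (auto simp: NE_turns_def)

lemma finite_NE_turns: "finite (NE_turns P)"
  by (rule finite_subset[OF NE_turns_subset]) simp

lemma NE_turnE:
  assumes "r \<in> NE_turns P"
  obtains j where "0 < j" "Suc j < length P" "r = P ! j"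
    "P ! j = P ! (j - 1) + (0, 1)" "P ! Suc j = P ! j + (1, 0)"
  using assms unfolding NE_turns_def
  by (auto) (metis add.commute diff_add_cancel)

text \<open>The horizontal step out of index \<open>i\<close> raises the abscissa, the vertical step
  into \<open>j\<close> the ordinate. Hence either coordinate alone can serve to count
  turns.\<close>

lemma NE_turns_strict_mono:
  assumes P: "lattice_path P"
    and "0 < j" "P ! Suc i = P ! i + (1, 0)" "P ! j = P ! (j - 1) + (0, 1)" "i < j" "j < length P"
  shows "fst (P ! i) < fst (P ! j) \<and> snd (P ! i) < snd (P ! j)"
  using lattice_path_mono[OF P, of "Suc i" j] lattice_path_mono[OF P, of i "j - 1"] assms by auto

lemma inj_on_NE_turns:
  assumes P: "lattice_path P"
  shows "inj_on fst (NE_turns P)" "inj_on snd (NE_turns P)"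
proof -
  have "r = s" if r: "r \<in> NE_turns P" and s: "s \<in> NE_turns P" and eq: "fst r = fst s \<or> snd r = snd s" for r s
  proof -
    obtain i where i: "0 < i" "Suc i < length P" "r = P ! i"
      "P ! i = P ! (i - 1) + (0, 1)" "P ! Suc i = P ! i + (1, 0)" using r by (rule NE_turnE)
    obtain j where j: "0 < j" "Suc j < length P" "s = P ! j"
      "P ! j = P ! (j - 1) + (0, 1)" "P ! Suc j = P ! j + (1, 0)" using s by (rule NE_turnE)
    have "\<not> i < j"
      using NE_turns_strict_mono[OF P j(1) i(5) j(4)] i(3) j(2,3) eq by auto
    moreover have "\<not> j < i"
      using NE_turns_strict_mono[OF P i(1) j(5) i(4)] i(2,3) j(3) eq by auto
    ultimately show ?thesis using i(3) j(3) by (metis linorder_neqE_nat)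
  qed
  then show "inj_on fst (NE_turns P)" "inj_on snd (NE_turns P)" by (auto simp: inj_on_def)
qed

lemma NE_turn_box:
  assumes P: "lattice_path P" "runs_from_to P p q" and r: "r \<in> NE_turns P"
  shows "fst r < fst q" "snd p < snd r"
proof -
  obtain j where j: "0 < j" "Suc j < length P" "r = P ! j"
    "P ! j = P ! (j - 1) + (0, 1)" "P ! Suc j = P ! j + (1, 0)" using r by (rule NE_turnE)
  have "fst (P ! Suc j) \<le> fst q" using lattice_path_box[OF P, of "P ! Suc j"] j(2) by simp
  then show "fst r < fst q" using j(3,5) by simp
  show "snd p < snd r" using lattice_path_box[OF P, of "P ! (j - 1)"] j by auto
qed

text \<open>Turns left of \<open>u\<close> are counted by ordinate, the others by abscissa. The last
  two hypotheses keep the interval sizes from being truncated at zero.\<close>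

lemma NE_le_if_weakly_south_east:
  assumes P: "lattice_path P" "runs_from_to P p q"
    and se: "weakly_south_east P (u, v)" and "u \<le> fst q" "snd p \<le> v"
  shows "int (NE P) \<le> fst q - snd p - (u - v)"
proof -
  let ?L = "{r \<in> NE_turns P. fst r < u}" and ?R = "{r \<in> NE_turns P. u \<le> fst r}"
  have "card ?L \<le> card {snd p + 1..v}"
  proof (rule card_inj_on_le[where f = snd])
    show "inj_on snd ?L" by (rule inj_on_subset[OF inj_on_NE_turns(2)[OF P(1)]]) auto
    show "snd ` ?L \<subseteq> {snd p + 1..v}"
      using NE_turn_box(2)[OF P] weakly_south_eastD[OF se] NE_turns_subset by fastforce
  qed simp
  moreover have "card ?R \<le> card {u..fst q - 1}"
  proof (rule card_inj_on_le[where f = fst])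
    show "inj_on fst ?R" by (rule inj_on_subset[OF inj_on_NE_turns(1)[OF P(1)]]) auto
    show "fst ` ?R \<subseteq> {u..fst q - 1}" using NE_turn_box(1)[OF P] by fastforce
  qed simp
  moreover have "NE P = card ?L + card ?R"
  proof -
    have "NE_turns P = ?L \<union> ?R" by auto
    moreover have "card (?L \<union> ?R) = card ?L + card ?R"
      by (rule card_Un_disjoint) (auto simp: finite_NE_turns)
    ultimately show ?thesis by (simp add: NE_def)
  qed
  ultimately show ?thesis using assms(4,5) by simp
qed

section \<open>Disjoint paths repel each other\<close>

lemma disjoint_paths_shift:
  assumes P: "lattice_path P" "runs_from_to P (0, a) (X, A)"
    and Q: "lattice_path Q" "runs_from_to Q (0, a') (X', A)"
    and "a' < a" "X < X'" and disj: "set P \<inter> set Q = {}"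
    and p: "p \<in> set P"
  shows "weakly_south_east Q (p + (1, -1))"
proof -
  note endP = lattice_path_endpoints[OF P] and endQ = lattice_path_endpoints[OF Q]
  note lenP = lattice_path_length[OF P] and lenQ = lattice_path_length[OF Q]
  note diagP = lattice_path_antidiagonal[OF P(1)] and diagQ = lattice_path_antidiagonal[OF Q(1)]
  \<comment> \<open>Both paths start at abscissa 0, so \<open>P ! j\<close> and
    \<open>Q ! (j + d)\<close> lie on the same antidiagonal.\<close>
  define d where "d = nat (a - a')"
  have d: "int d = a - a'" using \<open>a' < a\<close> by (simp add: d_def)
  have inQ: "j + d < length Q" if "j < length P" for j
    using that lenP lenQ d \<open>X < X'\<close> by simp
  \<comment> \<open>On a common antidiagonal the difference of the abscissae changes by at most one per step
    and never vanishes, so it keeps its initial sign.\<close>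
  have ne: "fst (P ! j) \<noteq> fst (Q ! (j + d))" if "j < length P" for j
  proof
    assume eq: "fst (P ! j) = fst (Q ! (j + d))"
    have "P ! j = Q ! (j + d)"
      using eq diagP[OF that] diagQ[OF inQ[OF that]] endP endQ d by (auto simp: prod_eq_iff)
    then show False using disj that inQ[OF that] by (metis disjoint_iff nth_mem)
  qed
  have less: "fst (P ! j) < fst (Q ! (j + d))" if "j < length P" for j
    using that
  proof (induction j)
    case 0
    have "fst (Q ! 0) \<le> fst (Q ! d)" using lattice_path_mono[OF Q(1), of 0 d] inQ[OF 0] by simp
    then show ?case using ne[OF 0] endP endQ by auto
  next
    case (Suc j)
    have "fst (P ! j) < fst (Q ! (j + d))" using Suc by simp
    moreover have "P ! Suc j = P ! j + (1, 0) \<or> P ! Suc j = P ! j + (0, 1)"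
      using lattice_path_step[OF P(1)] Suc by simp
    moreover have "fst (Q ! (j + d)) \<le> fst (Q ! (Suc j + d))"
      using lattice_path_mono[OF Q(1)] inQ[of "Suc j"] Suc by simp
    ultimately show ?case using ne[OF Suc.prems] by auto
  qed
  \<comment> \<open>If \<open>r\<close> were weakly north-west of \<open>p\<close>, the point of
    \<open>P\<close> on the antidiagonal of \<open>r\<close> would be strictly north-west of
    \<open>p\<close>, which is impossible on a monotone path.\<close>
  have "fst p + 1 \<le> fst r \<or> snd r \<le> snd p - 1" if r: "r \<in> set Q" for r
  proof (rule ccontr)
    assume "\<not> ?thesis"
    then have c: "fst r \<le> fst p" "snd p \<le> snd r" by auto
    obtain i where i: "i < length P" "p = P ! i" using p by (auto simp: in_set_conv_nth)
    obtain j where j: "j < length Q" "r = Q ! j" using r by (auto simp: in_set_conv_nth)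
    note boxp = lattice_path_box[OF P p] and boxr = lattice_path_box[OF Q r]
    have sr: "fst r + snd r = a' + int j" using diagQ[OF j(1)] j endQ by simp
    have dj: "d \<le> j" using c boxp boxr sr d by simp
    have "int j - int d < int (length P)" using c boxp boxr sr d lenP by simp
    then have jd: "j - d < length P" using dj by linarith
    have lt: "fst (P ! (j - d)) < fst r" using less[OF jd] dj j by simp
    have "fst (P ! (j - d)) + snd (P ! (j - d)) = fst r + snd r"
      using diagP[OF jd] sr d dj endP by (simp add: of_nat_diff)
    with lt have "snd r < snd (P ! (j - d))" by simp
    moreover have "fst p \<le> fst (P ! (j - d)) \<or> snd (P ! (j - d)) \<le> snd p"
      using lattice_path_mono[OF P(1), of i "j - d"] lattice_path_mono[OF P(1), of "j - d" i] i jd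
      by (cases "i \<le> j - d") auto
    ultimately show False using c lt by simp
  qed
  then show ?thesis by (fastforce simp: weakly_south_east_def)
qed

text \<open>\<open>P\<close> has a point on the column \<open>u\<close> at height at most
  \<open>v\<close>; repulsion from it gives a restriction at least as strong as the claimed
  one.\<close>

lemma weakly_south_east_shift:
  assumes P: "lattice_path P" "runs_from_to P (0, a) (X, A)"
    and Q: "lattice_path Q" "runs_from_to Q (0, a') (X', A)"
    and "a' < a" "X < X'" and disj: "set P \<inter> set Q = {}"
    and se: "weakly_south_east P (u, v)" and "0 \<le> u" "u \<le> X" "a \<le> v"
  shows "weakly_south_east Q (u + 1, v - 1)"
proof -
  obtain p where p: "p \<in> set P" "fst p = u" "snd p \<le> v"
    using weakly_south_east_witness[OF P se] assms by auto
  have "weakly_south_east Q (p + (1, -1))"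
    by (rule disjoint_paths_shift[OF P Q assms(5-7) p(1)])
  then show ?thesis using p by (fastforce simp: weakly_south_east_def)
qed

section \<open>Staircase paths\<close>

text \<open>The local \<open>x\<close> counts the horizontal steps among the first \<open>s\<close>:
  a run of \<open>h\<close>, then \<open>t\<close> vertical-horizontal pairs; the \<open>min\<close>
  makes all later steps vertical.\<close>

definition stair_point :: "int \<Rightarrow> nat \<Rightarrow> nat \<Rightarrow> nat \<Rightarrow> int \<times> int" where
  "stair_point a h t s =
     (let x = (if s \<le> h then s else min (h + (s - h) div 2) (h + t)) in (int x, a + int s - int x))"

definition stair_path :: "int \<Rightarrow> nat \<Rightarrow> nat \<Rightarrow> nat \<Rightarrow> (int \<times> int) list" where
  "stair_path a h t l = map (stair_point a h t) [0..<h + 2 * t + l + 1]"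

lemma stair_point_Suc:
  "stair_point a h t (Suc s) - stair_point a h t s \<in> {(1, 0), (0, 1)}"
proof (cases "s < h \<or> h + 2 * t \<le> s")
  case True
  then show ?thesis by (auto simp: stair_point_def Let_def min_def)
next
  case False
  then obtain k where "s = h + k" "k < 2 * t" using le_Suc_ex[of h s] by auto
  then show ?thesis by (cases "even k") (auto simp: stair_point_def Let_def min_def elim!: evenE oddE)
qed

lemma lattice_path_stair_path: "lattice_path (stair_path a h t l)"
  using stair_point_Suc[of a h t]
  by (auto simp: lattice_path_def successively_conv_nth stair_path_def simp del: upt_Suc)

lemma runs_from_to_stair_path:
  "runs_from_to (stair_path a h t l) (0, a) (int (h + t), a + int (t + l))"
proof -
  have "hd (stair_path a h t l) = stair_point a h t 0"
    by (simp add: stair_path_def hd_map del: upt_Suc)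
  moreover have "last (stair_path a h t l) = stair_point a h t (h + 2 * t + l)"
    by (simp add: stair_path_def)
  ultimately show ?thesis by (auto simp: runs_from_to_def stair_point_def Let_def min_def)
qed

text \<open>The alternatives are the initial horizontal run, the final vertical run and the
  staircase between two adjacent diagonals.\<close>

lemma stair_path_cases:
  assumes "(x, y) \<in> set (stair_path a h t l)"
  shows "y = a \<or> x = int (h + t) \<or> int h - a - 1 \<le> x - y"
  using assms by (auto simp: stair_path_def stair_point_def Let_def min_def split: if_splits)

lemma stair_path_diagonal_le:
  assumes "(x, y) \<in> set (stair_path a h t l)"
  shows "x - y \<le> int h - a"
  using assms by (auto simp: stair_path_def stair_point_def Let_def min_def split: if_splits)

text \<open>The turns sit at the odd offsets \<open>2 * k + 1\<close> after the horizontal run. The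
  converse inequality will come from the general upper bound.\<close>

lemma NE_stair_path_ge: "t \<le> NE (stair_path a h t l)"
proof -
  let ?f = "\<lambda>k. (int (h + k), a + int k + 1)"
  have "?f k \<in> NE_turns (stair_path a h t l)" if "k < t" for k
    unfolding NE_turns_def
    by (rule CollectI, rule exI[of _ "h + 2 * k + 1"])
      (use that in \<open>auto simp: stair_path_def stair_point_def Let_def min_def simp del: upt_Suc\<close>)
  then have "card (?f ` {..<t}) \<le> NE (stair_path a h t l)"
    unfolding NE_def by (intro card_mono finite_NE_turns) auto
  moreover have "card (?f ` {..<t}) = t" by (subst card_image) (auto simp: inj_on_def)
  ultimately show ?thesis by simp
qed

section \<open>The maximal number of NE-turns\<close>

text \<open>Each element is \<open>u - v\<close> for a point restricting path \<open>j\<close>,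
  after \<open>i - j\<close> moves by \<open>(1, -1)\<close>; for the points
  \<open>(x k, y k)\<close>, \<open>j\<close> is 1.\<close>

definition shifted_diagonals ::
  "int \<Rightarrow> int \<Rightarrow> (nat \<Rightarrow> int) \<Rightarrow> (nat \<Rightarrow> int) \<Rightarrow> nat \<Rightarrow> (nat \<Rightarrow> int) \<Rightarrow> (nat \<Rightarrow> int) \<Rightarrow> nat \<Rightarrow> int set" where
  "shifted_diagonals A B a b m x y i =
     (\<Union>j\<in>{1..i}. {- a j + 2 * (int i - int j), B - A - b j + 2 * (int i - int j)})
       \<union> {x k - y k + 2 * (int i - 1) | k. k \<in> {1..m}}"

lemma finite_shifted_diagonals: "finite (shifted_diagonals A B a b m x y i)"
  by (auto simp: shifted_diagonals_def)

lemma shifted_diagonals_nonempty: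
  "1 \<le> i \<Longrightarrow> shifted_diagonals A B a b m x y i \<noteq> {}"
  by (auto simp: shifted_diagonals_def)

lemma shifted_diagonals_mono:
  assumes "e \<in> shifted_diagonals A B a b m x y i" "i \<le> j"
  shows "e + 2 * (int j - int i) \<in> shifted_diagonals A B a b m x y j"
proof -
  consider l where "l \<in> {1..i}" "e = - a l + 2 * (int i - int l)"
    | l where "l \<in> {1..i}" "e = B - A - b l + 2 * (int i - int l)"
    | k where "k \<in> {1..m}" "e = x k - y k + 2 * (int i - 1)"
    using assms(1) unfolding shifted_diagonals_def by blast
  then show ?thesis
  proof cases
    case 1
    then show ?thesis using assms(2) unfolding shifted_diagonals_def
      by (intro UnI1 UN_I[of l]) auto
  next
    case 2
    then show ?thesis using assms(2) unfolding shifted_diagonals_def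
      by (intro UnI1 UN_I[of l]) auto
  next
    case 3
    then show ?thesis using assms(2) unfolding shifted_diagonals_def
      by (intro UnI2 CollectI exI[of _ k]) auto
  qed
qed

lemma strict_antimono_diff:
  fixes f :: "nat \<Rightarrow> int"
  assumes "\<And>i j. 1 \<le> i \<Longrightarrow> i < j \<Longrightarrow> j \<le> n \<Longrightarrow> f j < f i"
    and "1 \<le> i" "i \<le> j" "j \<le> n"
  shows "int j - int i \<le> f i - f j"
  using assms(3,4)
proof (induction j rule: dec_induct)
  case (step j)
  then show ?case using assms(1)[of j "Suc j"] assms(2) by auto
qed simp

text \<open>The last three hypotheses are added to the informal statement: with the others, they put
  each start weakly south-west of its end and each \<open>(x k, y k)\<close> in the bounding box of
  the first path.\<close>

theorem theorem7:
  fixes A B :: int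
    and n m :: nat
    and a b x y :: "nat \<Rightarrow> int"
  assumes "1 \<le> n"
    and "\<And>i j. 1 \<le> i \<Longrightarrow> i < j \<Longrightarrow> j \<le> n \<Longrightarrow> a j < a i"
    and "\<And>i j. 1 \<le> i \<Longrightarrow> i < j \<Longrightarrow> j \<le> n \<Longrightarrow> b j < b i"
    and "\<And>k. k \<in> {1..m} \<Longrightarrow> 0 \<le> x k \<and> x k \<le> B - b n"
    and "\<And>k. k \<in> {1..m} \<Longrightarrow> a n \<le> y k \<and> y k \<le> A"
    and "a 1 \<le> A" and "0 \<le> B - b 1"
    and "\<And>k. k \<in> {1..m} \<Longrightarrow> x k \<le> B - b 1 \<and> a 1 \<le> y k"
  shows "(\<exists>P \<in> path_families A B n a b m x y.
            int (\<Sum>i=1..n. NE (P i)) = (\<Sum>i=1..n. t_val A B a b m x y i)) \<and>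
         (\<forall>P \<in> path_families A B n a b m x y.
            int (\<Sum>i=1..n. NE (P i)) \<le> (\<Sum>i=1..n. t_val A B a b m x y i))"
proof -
  let ?D = "shifted_diagonals A B a b m x y"
  let ?t = "t_val A B a b m x y"
  define c where "c i = Max (?D i)" for i
  have t_eq: "?t i = B - a i - b i - c i" for i
    by (simp add: t_val_def c_def shifted_diagonals_def)
  have c_in: "c i \<in> ?D i" if "1 \<le> i" for i
    unfolding c_def by (rule Max_in[OF finite_shifted_diagonals shifted_diagonals_nonempty[OF that]])
  have c_ge: "e \<le> c i" if "e \<in> ?D i" for e i
    unfolding c_def by (rule Max_ge[OF finite_shifted_diagonals that])
  have c_mono: "c i + 2 * (int j - int i) \<le> c j" if "1 \<le> i" "i \<le> j" for i j
    by (rule c_ge[OF shifted_diagonals_mono[OF c_in]]) (use that in auto)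
  have a_diff: "int j - int i \<le> a i - a j" if "1 \<le> i" "i \<le> j" "j \<le> n" for i j
    by (rule strict_antimono_diff[of n a]) (use assms(2) that in auto)
  have b_diff: "int j - int i \<le> b i - b j" if "1 \<le> i" "i \<le> j" "j \<le> n" for i j
    by (rule strict_antimono_diff[of n b]) (use assms(3) that in auto)
  have a_ge: "- a i \<le> c i" and b_ge: "B - A - b i \<le> c i" if "1 \<le> i" for i
    by (rule c_ge, use that in \<open>force simp: shifted_diagonals_def\<close>)+
  have S_ge: "x k - y k \<le> c i" if "1 \<le> i" "k \<in> {1..m}" for i k
  proof -
    have "x k - y k + 2 * (int i - 1) \<le> c i"
      by (rule c_ge) (use that in \<open>auto simp: shifted_diagonals_def\<close>)
    then show ?thesis using that by simp
  qed

  have upper: "int (NE (P i)) \<le> ?t i" if P: "P \<in> path_families A B n a b m x y" and i: "i \<in> {1..n}" for P i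
  proof -
    have path: "lattice_path (P j)" "runs_from_to (P j) (0, a j) (B - b j, A)" if "j \<in> {1..n}" for j
      using P that by (auto simp: path_families_def)
    have disj: "set (P j) \<inter> set (P (Suc j)) = {}" if "1 \<le> j" "j < n" for j
      using P that by (auto simp: path_families_def non_intersecting_def)
    \<comment> \<open>One index at a time: \<open>a\<close> and \<open>b\<close> drop by at least
      one per index, so the moved point never passes right of the end or below the start of the
      current path.\<close>
    have shift: "weakly_south_east (P i) (u + (int i - int j), v - (int i - int j))"
      if "weakly_south_east (P j) (u, v)" "0 \<le> u" "u \<le> B - b j" "a j \<le> v" "1 \<le> j" "j \<le> i" "i \<le> n"
      for i j u v
      using that(6,7)
    proof (induction i rule: dec_induct)
      case base
      then show ?case using that(1) by simp
    next
      case (step i)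
      have "weakly_south_east (P (Suc i)) (u + (int i - int j) + 1, v - (int i - int j) - 1)"
        by (rule weakly_south_east_shift[of "P i" "a i" "B - b i" A _ "a (Suc i)" "B - b (Suc i)"])
          (use step that path[of i] path[of "Suc i"] disj[of i] assms(2)[of i "Suc i"]
            assms(3)[of i "Suc i"] a_diff[of j i] b_diff[of j i] in auto)
      then show ?case by (simp add: algebra_simps)
    qed
    have bound: "int (NE (P i)) \<le> B - b i - a i - (u - v + 2 * (int i - int j))"
      if "weakly_south_east (P j) (u, v)" "0 \<le> u" "u \<le> B - b j" "a j \<le> v" "j \<in> {1..i}" for j u v
    proof -
      have "weakly_south_east (P i) (u + (int i - int j), v - (int i - int j))"
        using shift[OF that(1-4)] that(5) i by simp
      from NE_le_if_weakly_south_east[OF path[OF i] this] show ?thesis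
        using that(3-5) i a_diff[of j i] b_diff[of j i] by auto
    qed
    have "1 \<le> i" using i by simp
    \<comment> \<open>The maximum stems from a point that restricts some path \<open>j\<close>: its
      start (abscissae are nonnegative), its end (ordinates are at most \<open>A\<close>), or a
      given point, taken for path 1.\<close>
    from c_in[OF this]
    consider j where "j \<in> {1..i}" "c i = - a j + 2 * (int i - int j)"
      | j where "j \<in> {1..i}" "c i = B - A - b j + 2 * (int i - int j)"
      | k where "k \<in> {1..m}" "c i = x k - y k + 2 * (int i - 1)"
      unfolding shifted_diagonals_def by blast
    then show ?thesis
    proof cases
      case 1
      then have j: "j \<in> {1..n}" using i by auto
      have "weakly_south_east (P j) (0, a j)"
        using lattice_path_box[OF path[OF j]] by (fastforce simp: weakly_south_east_def)
      from bound[OF this] 1 j assms(7) b_diff[of 1 j] show ?thesis by (auto simp: t_eq)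
    next
      case 2
      then have j: "j \<in> {1..n}" using i by auto
      have "weakly_south_east (P j) (B - b j, A)"
        using lattice_path_box[OF path[OF j]] by (fastforce simp: weakly_south_east_def)
      from bound[OF this] 2 j assms(6,7) a_diff[of 1 j] b_diff[of 1 j] show ?thesis
        by (auto simp: t_eq)
    next
      case 3
      have "weakly_south_east (P 1) (x k, y k)"
        using P 3 assms(1) by (auto simp: path_families_def)
      from bound[OF this] 3 i assms(4,8)[OF 3(1)] show ?thesis by (auto simp: t_eq)
    qed
  qed

  \<comment> \<open>The start lies on the diagonal \<open>- a i\<close> and the end on
    \<open>B - b i - A\<close>; \<open>h i\<close> and \<open>l i\<close> are their distances to the
    diagonal \<open>c i\<close>.\<close>
  define h where "h i = nat (a i + c i)" for i
  define l where "l i = nat (A - B + b i + c i)" for i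
  define P where "P i = stair_path (a i) (h i) (nat (?t i)) (l i)" for i
  have h: "int (h i) = a i + c i" and l: "int (l i) = A - B + b i + c i" if "i \<in> {1..n}" for i
    using that a_ge[of i] b_ge[of i] by (simp_all add: h_def l_def)
  \<comment> \<open>Nonnegativity of \<open>?t i\<close>: the drops of \<open>a\<close> and
    \<open>b\<close> from \<open>j\<close> to \<open>i\<close> absorb the term
    \<open>2 * (int i - int j)\<close>.\<close>
  have t: "int (nat (?t i)) = B - a i - b i - c i" if "i \<in> {1..n}" for i
  proof -
    from that have "1 \<le> i" by simp
    from c_in[OF this]
    consider j where "j \<in> {1..i}" "c i = - a j + 2 * (int i - int j)"
      | j where "j \<in> {1..i}" "c i = B - A - b j + 2 * (int i - int j)"
      | k where "k \<in> {1..m}" "c i = x k - y k + 2 * (int i - 1)"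
      unfolding shifted_diagonals_def by blast
    then have "a i + b i + c i \<le> B"
    proof cases
      case 1
      then show ?thesis using that a_diff[of j i] b_diff[of j i] b_diff[of 1 j] assms(7) by auto
    next
      case 2
      then show ?thesis using that a_diff[of j i] b_diff[of j i] a_diff[of 1 j] assms(6) by auto
    next
      case 3
      then show ?thesis using that a_diff[of 1 i] b_diff[of 1 i] assms(8)[of k] by auto
    qed
    then show ?thesis by (simp add: t_eq)
  qed
  have cases_P: "q = a i \<or> p = B - b i \<or> c i - 1 \<le> p - q" and diag_P: "p - q \<le> c i"
    if "i \<in> {1..n}" "(p, q) \<in> set (P i)" for i p q
    using stair_path_cases[OF that(2)[unfolded P_def]] stair_path_diagonal_le[OF that(2)[unfolded P_def]]
      h[OF that(1)] t[OF that(1)] by auto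
  have path: "lattice_path (P i)" "runs_from_to (P i) (0, a i) (B - b i, A)" if "i \<in> {1..n}" for i
  proof -
    have "int (h i + nat (?t i)) = B - b i" "a i + int (nat (?t i) + l i) = A"
      unfolding of_nat_add h[OF that] t[OF that] l[OF that] by simp_all
    then show "runs_from_to (P i) (0, a i) (B - b i, A)"
      using runs_from_to_stair_path[of "a i" "h i" "nat (?t i)" "l i"] unfolding P_def by metis
    show "lattice_path (P i)" unfolding P_def by (rule lattice_path_stair_path)
  qed
  have disj: "set (P i) \<inter> set (P j) = {}" if "i \<in> {1..n}" "j \<in> {1..n}" "i < j" for i j
  proof -
    \<comment> \<open>The horizontal run of path \<open>j\<close> is below path \<open>i\<close>,
      its vertical run to the right; its staircase has \<open>p - q\<close> at least
      \<open>c j - 1\<close>, which exceeds \<open>c i\<close>.\<close>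
    have False if r: "(p, q) \<in> set (P i)" "(p, q) \<in> set (P j)" for p q
      using cases_P[OF \<open>j \<in> {1..n}\<close> r(2)] diag_P[OF \<open>i \<in> {1..n}\<close> r(1)] c_mono[of i j]
        lattice_path_box[OF path[OF \<open>i \<in> {1..n}\<close>] r(1)] assms(2)[of i j] assms(3)[of i j] that(1)
        \<open>i \<in> {1..n}\<close> \<open>j \<in> {1..n}\<close> \<open>i < j\<close> by auto
    then show ?thesis by auto
  qed
  have "P \<in> path_families A B n a b m x y"
  proof -
    have "non_intersecting n P"
      unfolding non_intersecting_def using disj by (metis inf_commute linorder_neqE_nat)
    moreover have "weakly_south_east (P i) (x k, y k)" if i: "i \<in> {1..n}" and k: "k \<in> {1..m}" for i k
    proof -
      \<comment> \<open>A violating point has \<open>p - q\<close> at most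
        \<open>x k - y k - 2\<close>, so the lower staircase diagonal \<open>c i - 1\<close> is
        still safe.\<close>
      have "x k \<le> p \<or> q \<le> y k" if "(p, q) \<in> set (P i)" for p q
        using cases_P[OF i that] S_ge[of i k] i k assms(8)[OF k] a_diff[of 1 i] b_diff[of 1 i] by auto
      then show ?thesis by (auto simp: weakly_south_east_def)
    qed
    ultimately show ?thesis using path by (simp add: path_families_def)
  qed
  moreover have "int (NE (P i)) = ?t i" if "i \<in> {1..n}" for i
    using upper[OF calculation that] NE_stair_path_ge[of "nat (?t i)" "a i" "h i" "l i"]
    by (simp add: P_def)
  ultimately show ?thesis using upper by (auto intro!: bexI[of _ P] sum_mono)
qed

end
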